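(* Let $\rho=\frac{\lambda z_0}{\ell A}$ and suppose that $\frac2\rho\in\mathbb{N}$ and $m\le\frac{\delta}{2}e^{K^2/2}$ for some $\delta>0$ and $K>0$. Then with probability (over the sensor ensemble) greater than $$1-2\delta-\frac{\rho\,n(n-1)^{3/2}}{m^{1/2}},$$ all target vectors $X\in\mathbb C^m$ of sparsity $$s<\frac12\left(1+\frac{\sqrt n}{\sqrt2\,K}\right)$$ can be recovered exactly, by Basis Pursuit as well as by Orthogonal Matching Pursuit, from $Y=\mathbf A^{\rm SA}X$, where $\mathbf A^{\rm SA}$ is the synthetic aperture sensing matrix.
   Context: Fix real numbers $z_0,\ell,A,\lambda>0$ and set $\omega=2\pi/\lambda$. Let $m$ be a perfect square. Target grid: $\mathcal{M}=\{\mathbf r_j=(x_j,y_j,z_0): j=1,\dots,m\}$ is a $\sqrt m\times\sqrt m$ square lattice of mesh size $\ell$ in the plane $\{z=z_0\}$. Sensor ensemble: the sensor locations are $\mathbf a_q=(\xi_q,\eta_q,0)$, $q=1,\dots,n$, where $(\xi_q,\eta_q)$ are i.i.d. uniformly distributed in $[0,A]\times[0,A]$. Let $G(\mathbf r,\mathbf a)=\frac{e^{i\omega z_0}}{4\pi z_0}e^{i\omega|x-\xi|^2/(2z_0)}e^{i\omega|y-\eta|^2/(2z_0)}$ be the paraxial Green function for $\mathbf r=(x,y,z_0)$, $\mathbf a=(\xi,\eta,0)$. The synthetic aperture (SA) sensing matrix $\mathbf A^{\rm SA}$ is the $n\times m$ matrix with entries $G^2(\mathbf a_q,\mathbf r_j)$,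 normalized so that columns have unit $\ell^2$-norm; i.e. up to a constant unimodular factor $$A^{\rm SA}_{qj}=\frac1{\sqrt n}\exp\!\Big(\tfrac{i\omega}{z_0}\big[(x_j-\xi_q)^2+(y_j-\eta_q)^2\big]\Big).$$ The sparsity of $X$ is $s=\|X\|_0$, its number of nonzero entries. Basis Pursuit (BP): given $Y$, solve $\min\|Z\|_1$ subject to $\mathbf A^{\rm SA} Z=Y$; exact recovery means $X$ is the unique minimizer. Orthogonal Matching Pursuit (OMP): start with residual $Y$ and empty index set; at each step add an index of a column having maximal absolute inner product with the current residual, and replace the residual by $Y$ minus its orthogonal projection onto the span of the selected columns; exact recovery means that after $s$ steps the least-squares coefficients on the selected columns give $X$. *)

theory Defs
  imports "HOL-Probability.Probability"
begin

text \<open>The paraxial Green function between points of two parallel planes at distance \<open>d\<close>; it is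
  symmetric in its two arguments. For \<open>r = (x, y, z\<^sub>0)\<close> and \<open>a = (\<xi>, \<eta>, 0)\<close> with
  \<open>z\<^sub>0 > 0\<close> one has \<open>d = z\<^sub>0\<close>.\<close>

definition paraxial_green :: "real \<Rightarrow> real \<times> real \<times> real \<Rightarrow> real \<times> real \<times> real \<Rightarrow> complex" where
  "paraxial_green \<omega> = (\<lambda>(x, y, z) (\<xi>, \<eta>, w).
     let d = \<bar>z - w\<bar> in
       exp (\<i> * of_real (\<omega> * d)) / of_real (4 * pi * d)
       * exp (\<i> * of_real (\<omega> * \<bar>x - \<xi>\<bar>\<^sup>2 / (2 * d)))
       * exp (\<i> * of_real (\<omega> * \<bar>y - \<eta>\<bar>\<^sup>2 / (2 * d))))"

definition square_lattice :: "real \<times> real \<times> real \<Rightarrow> real \<Rightarrow> nat \<Rightarrow> (real \<times> real \<times> real) set" where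
  "square_lattice = (\<lambda>(x0, y0, z0) l p.
     {(x0 + l * real a, y0 + l * real b, z0) | a b. a < p \<and> b < p})"

definition normalize_columns :: "complex^'m^'n \<Rightarrow> complex^'m^'n" where
  "normalize_columns B = (\<chi> q j. B $ q $ j / of_real (norm (column j B)))"

definition sa_matrix ::
    "real \<Rightarrow> ('m \<Rightarrow> real \<times> real \<times> real) \<Rightarrow> ('n \<Rightarrow> real \<times> real \<times> real) \<Rightarrow> complex^'m^'n" where
  "sa_matrix \<omega> r a = normalize_columns (\<chi> q j. (paraxial_green \<omega> (a q) (r j))\<^sup>2)"

lemma sa_matrix_nth:
  fixes r :: "'m::finite \<Rightarrow> real \<times> real \<times> real" and a :: "'n::finite \<Rightarrow> real \<times> real \<times> real"
  assumes "z0 > 0" and "r j = (x, y, z0)"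
    and a: "\<And>q. a q = (\<xi> q, \<eta> q, 0)"
  shows "sa_matrix \<omega> r a $ q $ j =
    exp (\<i> * of_real (2 * \<omega> * z0)) * (1 / of_real (sqrt (real CARD('n)))
    * exp (\<i> * of_real (\<omega> / z0 * ((x - \<xi> q)\<^sup>2 + (y - \<eta> q)\<^sup>2))))"
proof -
  have G: "(paraxial_green \<omega> (a k) (r j))\<^sup>2 =
      exp (\<i> * of_real (2 * \<omega> * z0)) * exp (\<i> * of_real (\<omega> / z0 * ((x - \<xi> k)\<^sup>2 + (y - \<eta> k)\<^sup>2)))
      / of_real ((4 * pi * z0)\<^sup>2)" for k
  proof -
    have "(paraxial_green \<omega> (a k) (r j))\<^sup>2 =
        (exp (\<i> * of_real (\<omega> * z0)) * exp (\<i> * of_real (\<omega> * (\<xi> k - x)\<^sup>2 / (2 * z0)))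
         * exp (\<i> * of_real (\<omega> * (\<eta> k - y)\<^sup>2 / (2 * z0))))\<^sup>2 / of_real ((4 * pi * z0)\<^sup>2)"
      using assms by (simp add: paraxial_green_def Let_def power_divide power_mult_distrib)
    also have "\<dots> = exp (2 * (\<i> * of_real (\<omega> * z0) + \<i> * of_real (\<omega> * (\<xi> k - x)\<^sup>2 / (2 * z0))
         + \<i> * of_real (\<omega> * (\<eta> k - y)\<^sup>2 / (2 * z0)))) / of_real ((4 * pi * z0)\<^sup>2)"
      by (simp only: exp_add exp_double)
    also have "2 * (\<i> * of_real (\<omega> * z0) + \<i> * of_real (\<omega> * (\<xi> k - x)\<^sup>2 / (2 * z0))
         + \<i> * of_real (\<omega> * (\<eta> k - y)\<^sup>2 / (2 * z0))) =
        \<i> * of_real (2 * \<omega> * z0) + \<i> * of_real (\<omega> / z0 * ((x - \<xi> k)\<^sup>2 + (y - \<eta> k)\<^sup>2))"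
      using \<open>z0 > 0\<close> by (simp add: field_simps power2_commute)
    finally show ?thesis by (simp only: exp_add)
  qed
  define B :: "complex^'m^'n" where "B = (\<chi> q j. (paraxial_green \<omega> (a q) (r j))\<^sup>2)"
  have "cmod (column j B $ k) = 1 / (4 * pi * z0)\<^sup>2" for k
    unfolding B_def column_def vec_lambda_beta G norm_divide norm_mult norm_exp_i_times
    using \<open>z0 > 0\<close> by (simp add: norm_mult norm_power abs_mult)
  moreover have "sqrt (t ^ 4) = t\<^sup>2" for t :: real
    by (rule real_sqrt_unique) simp_all
  ultimately have "norm (column j B) = sqrt (real CARD('n)) / (4 * pi * z0)\<^sup>2"
    by (simp add: norm_vec_def L2_set_def real_sqrt_mult power_divide real_sqrt_divide)
  moreover have "sa_matrix \<omega> r a $ q $ j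
      = (paraxial_green \<omega> (a q) (r j))\<^sup>2 / of_real (norm (column j B))"
    by (simp add: sa_matrix_def normalize_columns_def B_def)
  ultimately show ?thesis unfolding G using \<open>z0 > 0\<close> by simp
qed

definition support :: "complex^'m \<Rightarrow> 'm set" where
  "support X = {j. X $ j \<noteq> 0}"

definition sparsity :: "complex^'m \<Rightarrow> nat" where
  "sparsity X = card (support X)"

definition l1_norm :: "complex^'m \<Rightarrow> real" where
  "l1_norm X = (\<Sum>j\<in>UNIV. cmod (X $ j))"

definition BP_minimizers :: "complex^'m^'n \<Rightarrow> complex^'n \<Rightarrow> (complex^'m) set" where
  "BP_minimizers A Y = {Z. A *v Z = Y \<and> (\<forall>W. A *v W = Y \<longrightarrow> l1_norm Z \<le> l1_norm W)}"

definition BP_recovers :: "complex^'m^'n \<Rightarrow> complex^'m \<Rightarrow> bool" where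
  "BP_recovers A X \<longleftrightarrow> BP_minimizers A (A *v X) = {X}"

text \<open>The inner product \<open>\<bullet>\<close> of the library on \<open>complex^'n\<close> is real valued, so the Hermitian
  one is defined here; it induces the same norm. Likewise, \<open>vec.span\<close> is the span over
  the complex field, while \<open>span\<close> would be the span over the reals.\<close>

definition hermitian :: "complex^'n \<Rightarrow> complex^'n \<Rightarrow> complex" where
  "hermitian u v = (\<Sum>q\<in>UNIV. cnj (u $ q) * v $ q)"

definition orth_proj :: "(complex^'n) set \<Rightarrow> complex^'n \<Rightarrow> complex^'n" where
  "orth_proj V y = (THE p. p \<in> V \<and> (\<forall>v\<in>V. hermitian v (y - p) = 0))"

text \<open>\<open>OMP_run A Y k S R\<close>: after \<open>k\<close> steps on input \<open>Y\<close>, with ties for the maximum broken in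
  some way, the selected indices are \<open>S\<close> and the residual is \<open>R\<close>.\<close>

inductive OMP_run :: "complex^'m^'n \<Rightarrow> complex^'n \<Rightarrow> nat \<Rightarrow> 'm set \<Rightarrow> complex^'n \<Rightarrow> bool"
  for A :: "complex^'m^'n" and Y :: "complex^'n" where
  start: "OMP_run A Y 0 {} Y"
| step: "OMP_run A Y k S R \<Longrightarrow>
    (\<And>i. cmod (hermitian (column i A) R) \<le> cmod (hermitian (column j A) R)) \<Longrightarrow>
    OMP_run A Y (Suc k) (insert j S)
      (Y - orth_proj (vec.span ((\<lambda>i. column i A) ` insert j S)) Y)"

definition least_squares :: "complex^'m^'n \<Rightarrow> complex^'n \<Rightarrow> 'm set \<Rightarrow> (complex^'m) set" where
  "least_squares A Y S = {Z. support Z \<subseteq> S \<and>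
     (\<forall>W. support W \<subseteq> S \<longrightarrow> norm (Y - A *v Z) \<le> norm (Y - A *v W))}"

text \<open>Recovery is required for every way of breaking ties.\<close>

definition OMP_recovers :: "complex^'m^'n \<Rightarrow> complex^'m \<Rightarrow> bool" where
  "OMP_recovers A X \<longleftrightarrow>
     (\<forall>S R. OMP_run A (A *v X) (sparsity X) S R \<longrightarrow> least_squares A (A *v X) S = {X})"

end

(* A matrix with unit columns and mutual coherence at most \<mu> recovers every X with
   (2s - 1) \<mu> < 1, both by Basis Pursuit (null space property) and by Orthogonal Matching Pursuit
   (a correlation with a column outside the support is never maximal). So it suffices to show that
   the coherence is at most sqrt 2 K / sqrt n.

   Two columns have the inner product 1/n \<Sum>q exp (i \<kappa> (a \<xi>_q + b \<eta>_q)) up to a unimodular factor, where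
   (a, b) is the difference of the two lattice points in units of the mesh size. Hence only
   4 (m - sqrt m) nonzero differences enter the union bound, and 2/\<rho> \<in> \<nat> makes every summand have
   mean zero. Hoeffding's inequality for the real and the imaginary part would lose too much for the
   constant 2\<delta>; projecting on three lines at mutual angles of 60 degrees instead gives the tail
   6 exp (- 3/4 K^2) per difference, and the union bound then is at most 3/2 \<delta> when \<delta> \<le> 1/2. *)

theory Submission imports Defs begin

subsection \<open>Recovery from small coherence\<close>

lemma hermitian_diff_right: "hermitian u (v - w) = hermitian u v - hermitian u w"
  by (simp add: hermitian_def algebra_simps sum_subtractf)

lemma hermitian_scale_left: "hermitian (c *s u) v = cnj c * hermitian u v"
  by (simp add: hermitian_def sum_distrib_left mult_ac)

lemma hermitian_self: "hermitian v v = of_real ((norm v)\<^sup>2)"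
proof -
  have "cnj z * z = of_real ((cmod z)\<^sup>2)" for z
    using complex_norm_square[of z] by (simp add: mult.commute)
  then show ?thesis
    by (simp add: hermitian_def norm_vec_def L2_set_def sum_nonneg)
qed

lemma Re_hermitian: "Re (hermitian u v) = u \<bullet> v"
  by (simp add: hermitian_def inner_vec_def inner_complex_def)

lemma hermitian_matrix_vector_mult:
  "hermitian u (A *v c) = (\<Sum>j\<in>UNIV. c $ j * hermitian u (column j A))"
proof -
  have "hermitian u (A *v c) = (\<Sum>q\<in>UNIV. \<Sum>j\<in>UNIV. cnj (u $ q) * (A $ q $ j * c $ j))"
    by (simp add: hermitian_def matrix_vector_mult_def sum_distrib_left)
  also have "\<dots> = (\<Sum>j\<in>UNIV. \<Sum>q\<in>UNIV. cnj (u $ q) * (A $ q $ j * c $ j))"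
    by (rule sum.swap)
  finally show ?thesis
    by (simp add: hermitian_def column_def sum_distrib_left mult_ac)
qed

text \<open>A complex subspace is also a real one, and the real inner product is the real part of
  \<open>hermitian\<close>, so real orthogonal decomposition makes the real part of
  \<open>hermitian v z\<close> vanish. Testing against \<open>\<i> *s v\<close>, which also lies in
  \<open>V\<close>, makes the imaginary part vanish.\<close>

lemma orth_proj_exists:
  fixes y :: "complex^'n"
  assumes V: "vec.subspace V"
  shows "\<exists>p. p \<in> V \<and> (\<forall>v\<in>V. hermitian v (y - p) = 0)"
proof -
  have "subspace V"
  proof (rule subspaceI)
    show "c *\<^sub>R x \<in> V" if "x \<in> V" for c x
    proof -
      have "c *\<^sub>R x = of_real c *s x"
        by (simp add: vec_eq_iff scaleR_conv_of_real[where 'a=complex])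
      then show ?thesis using vec.subspace_scale[OF V that] by simp
    qed
  qed (use V vec.subspace_0 vec.subspace_add in blast)+
  then have span: "span V = V" by (simp add: span_eq_iff)
  obtain p z where p: "p \<in> V" and orth: "\<And>v. v \<in> V \<Longrightarrow> orthogonal z v" and "y = p + z"
    using orthogonal_subspace_decomp_exists[of V y] unfolding span by blast
  then have z: "y - p = z" by simp
  have "hermitian v z = 0" if v: "v \<in> V" for v
  proof -
    have re: "Re (hermitian w z) = 0" if "w \<in> V" for w
      using orth[OF that] by (simp add: Re_hermitian orthogonal_def inner_commute)
    have "\<i> *s v \<in> V" using vec.subspace_scale[OF V v] .
    from re[OF this] have "Im (hermitian v z) = 0" by (simp add: hermitian_scale_left)
    with re[OF v] show ?thesis by (simp add: complex_eq_iff)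
  qed
  with p z show ?thesis by blast
qed

text \<open>Justifies the definite description in \<open>orth_proj\<close>: the difference of two
  candidates lies in \<open>V\<close> and is orthogonal to itself, hence zero.\<close>

lemma orth_proj:
  fixes y :: "complex^'n"
  assumes V: "vec.subspace V"
  shows orth_proj_mem: "orth_proj V y \<in> V"
    and hermitian_diff_orth_proj: "v \<in> V \<Longrightarrow> hermitian v (y - orth_proj V y) = 0"
proof -
  have "\<exists>!p. p \<in> V \<and> (\<forall>v\<in>V. hermitian v (y - p) = 0)"
  proof (rule ex_ex1I[OF orth_proj_exists[OF V]])
    fix p p' assume p: "p \<in> V \<and> (\<forall>v\<in>V. hermitian v (y - p) = 0)"
      and p': "p' \<in> V \<and> (\<forall>v\<in>V. hermitian v (y - p') = 0)"
    then have d: "p - p' \<in> V" using vec.subspace_diff[OF V] by blast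
    have "hermitian (p - p') ((y - p') - (y - p)) = 0"
      using p p' d by (subst hermitian_diff_right) simp
    then have "hermitian (p - p') (p - p') = 0" by simp
    then show "p = p'" by (simp add: hermitian_self)
  qed
  from theI'[OF this] show "orth_proj V y \<in> V"
    "v \<in> V \<Longrightarrow> hermitian v (y - orth_proj V y) = 0"
    unfolding orth_proj_def by blast+
qed

text \<open>The images of the vectors supported in \<open>S\<close> form a complex subspace
  containing the given columns, hence also their span. This turns the projections of a greedy run
  back into coefficient vectors.\<close>

lemma span_columns_obtain:
  fixes A :: "complex^'m^'n"
  assumes "p \<in> vec.span ((\<lambda>i. column i A) ` S)"
  obtains d where "support d \<subseteq> S" "p = A *v d"
proof -
  let ?W = "{A *v d | d. support d \<subseteq> S}"
  have "vec.subspace ?W"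
  proof (rule vec.subspaceI)
    show "0 \<in> ?W"
      by (rule CollectI, rule exI[of _ 0]) (simp add: support_def)
    show "x + y \<in> ?W" if "x \<in> ?W" "y \<in> ?W" for x y
    proof -
      from that obtain d e where "support d \<subseteq> S" "x = A *v d" "support e \<subseteq> S" "y = A *v e" by blast
      moreover from this have "support (d + e) \<subseteq> S" by (force simp: support_def)
      ultimately show ?thesis
        by (intro CollectI exI[of _ "d + e"]) (simp add: matrix_vector_right_distrib)
    qed
    show "c *s x \<in> ?W" if "x \<in> ?W" for c x
    proof -
      from that obtain d where "support d \<subseteq> S" "x = A *v d" by blast
      moreover from this have "support (c *s d) \<subseteq> S" by (auto simp: support_def)
      ultimately show ?thesis
        by (intro CollectI exI[of _ "c *s d"]) (simp add: vector_scalar_commute)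
    qed
  qed
  moreover have "(\<lambda>i. column i A) ` S \<subseteq> ?W"
  proof (rule image_subsetI)
    fix i assume "i \<in> S"
    then have "support (axis i 1 :: complex^'m) \<subseteq> S" by (auto simp: support_def axis_def split: if_splits)
    moreover have "A *v axis i 1 = column i A" 
      by (simp add: vec_eq_iff matrix_vector_mult_def column_def axis_def if_distrib[of "\<lambda>z. _ * z"] cong: if_cong)
    ultimately show "column i A \<in> ?W" by (intro CollectI exI[of _ "axis i 1"] conjI) simp_all
  qed
  ultimately have "vec.span ((\<lambda>i. column i A) ` S) \<subseteq> ?W" by (rule vec.span_minimal[rotated])
  with assms that show ?thesis by blast
qed

section \<open>Incoherent matrices: null space property and Basis Pursuit\<close>

locale incoherent =
  fixes A :: "complex^'m^'n" and \<mu> :: real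
  assumes mu_nonneg: "\<mu> \<ge> 0"
    and hermitian_column_self: "hermitian (column j A) (column j A) = 1"
    and coherence: "i \<noteq> j \<Longrightarrow> cmod (hermitian (column i A) (column j A)) \<le> \<mu>"
begin

text \<open>Expanding \<open>A *v h\<close> in columns, the unit column \<open>i\<close> contributes
  exactly \<open>h $ i\<close>, and every other entry of \<open>h\<close> is damped by a factor of
  at most \<mu>. Both recovery arguments rest on this estimate.\<close>

lemma correlation_bound:
  "cmod (hermitian (column i A) (A *v h) - h $ i) \<le> \<mu> * (l1_norm h - cmod (h $ i))"
proof -
  have "hermitian (column i A) (A *v h) - h $ i
      = (\<Sum>j\<in>UNIV - {i}. h $ j * hermitian (column i A) (column j A))"
    unfolding hermitian_matrix_vector_mult
    by (subst sum.remove[of UNIV i]) (simp_all add: hermitian_column_self)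
  also have "cmod \<dots> \<le> (\<Sum>j\<in>UNIV - {i}. \<mu> * cmod (h $ j))"
  proof (rule sum_norm_le)
    fix j assume "j \<in> UNIV - {i}"
    then show "cmod (h $ j * hermitian (column i A) (column j A)) \<le> \<mu> * cmod (h $ j)"
      using mult_right_mono[OF coherence[of i j], of "cmod (h $ j)"] by (simp add: norm_mult mult_ac)
  qed
  also have "\<dots> = \<mu> * (l1_norm h - cmod (h $ i))"
    unfolding l1_norm_def by (simp add: sum_distrib_left[symmetric] sum_diff1)
  finally show ?thesis .
qed

text \<open>On the kernel, \<open>correlation_bound\<close> says that no entry exceeds the fraction
  \<mu> / (1 + \<mu>) of the l1 norm. Hence \<open>T\<close> carries at most \<open>card T\<close>
  times this fraction, which is below 1/2 exactly under the stated condition.\<close>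

lemma null_space_property:
  assumes "A *v h = 0" and "h \<noteq> 0" and T: "(2 * real (card T) - 1) * \<mu> < 1"
  shows "(\<Sum>j\<in>T. cmod (h $ j)) < l1_norm h / 2"
proof -
  have pos: "l1_norm h > 0"
  proof -
    obtain i where "h $ i \<noteq> 0" using \<open>h \<noteq> 0\<close> by (auto simp: vec_eq_iff)
    then show ?thesis unfolding l1_norm_def by (intro sum_pos2[of _ i]) auto
  qed
  have "(1 + \<mu>) * cmod (h $ i) \<le> \<mu> * l1_norm h" for i
    using correlation_bound[of i h] \<open>A *v h = 0\<close> by (simp add: hermitian_def algebra_simps)
  then have "(\<Sum>j\<in>T. (1 + \<mu>) * cmod (h $ j)) \<le> (\<Sum>j\<in>T. \<mu> * l1_norm h)"
    by (rule sum_mono)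
  then have "(1 + \<mu>) * (2 * (\<Sum>j\<in>T. cmod (h $ j))) \<le> (2 * real (card T) * \<mu>) * l1_norm h"
    unfolding sum_distrib_left[symmetric] by (simp add: mult_ac)
  also have "\<dots> < (1 + \<mu>) * l1_norm h"
    using T pos by (intro mult_strict_right_mono) (auto simp: algebra_simps)
  finally have "2 * (\<Sum>j\<in>T. cmod (h $ j)) < l1_norm h"
    using mu_nonneg by (simp add: mult_less_cancel_left_pos)
  then show ?thesis by simp
qed

text \<open>A nonzero \<open>h\<close> would have all of its l1 mass on \<open>T\<close>, where the
  null space property allows less than half. This gives uniqueness of the least-squares
  solution.\<close>

lemma sparse_kernel_trivial:
  assumes "A *v h = 0" and "support h \<subseteq> T" and "(2 * real (card T) - 1) * \<mu> < 1"
  shows "h = 0"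
proof (rule ccontr)
  assume "h \<noteq> 0"
  have "(\<Sum>j\<in>T. cmod (h $ j)) = l1_norm h"
    unfolding l1_norm_def using assms(2) by (intro sum.mono_neutral_left) (auto simp: support_def)
  moreover have "l1_norm h \<ge> 0" by (simp add: l1_norm_def sum_nonneg)
  ultimately show False using null_space_property[OF assms(1) \<open>h \<noteq> 0\<close> assms(3)] by simp
qed

text \<open>Write Z = X + h. On the support of \<open>X\<close> the l1 norm drops by at most the
  mass of \<open>h\<close> there; off the support it grows by the full mass of \<open>h\<close>,
  which is strictly larger.\<close>

lemma l1_norm_less:
  assumes "A *v Z = A *v X" and "Z \<noteq> X" and "(2 * real (sparsity X) - 1) * \<mu> < 1"
  shows "l1_norm X < l1_norm Z"
proof -
  define h where "h = Z - X"
  let ?T = "support X"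
  have l1: "l1_norm v = (\<Sum>j\<in>?T. cmod (v $ j)) + (\<Sum>j\<in>-?T. cmod (v $ j))" for v
    unfolding l1_norm_def by (subst sum.union_disjoint[symmetric]) auto
  have "A *v h = 0" "h \<noteq> 0"
    using assms by (simp_all add: h_def matrix_vector_mult_diff_distrib)
  then have "(\<Sum>j\<in>?T. cmod (h $ j)) < l1_norm h / 2"
    using assms(3) unfolding sparsity_def by (rule null_space_property)
  then have *: "(\<Sum>j\<in>?T. cmod (h $ j)) < (\<Sum>j\<in>-?T. cmod (h $ j))"
    unfolding l1[of h] by simp
  have "cmod (X $ j) - cmod (h $ j) \<le> cmod (Z $ j)" for j
    using norm_triangle_ineq2[of "X $ j" "X $ j - Z $ j"] by (simp add: h_def norm_minus_commute)
  then have "(\<Sum>j\<in>?T. cmod (X $ j) - cmod (h $ j)) \<le> (\<Sum>j\<in>?T. cmod (Z $ j))" by (rule sum_mono)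
  moreover have "(\<Sum>j\<in>-?T. cmod (h $ j)) = (\<Sum>j\<in>-?T. cmod (Z $ j))"
    by (rule sum.cong) (auto simp: h_def support_def)
  moreover have "(\<Sum>j\<in>-?T. cmod (X $ j)) = 0"
    by (rule sum.neutral) (auto simp: support_def)
  ultimately show ?thesis using * unfolding l1[of X] l1[of Z] by (simp add: sum_subtractf)
qed

theorem BP_recovers:
  assumes "(2 * real (sparsity X) - 1) * \<mu> < 1"
  shows "BP_recovers A X"
proof -
  have less: "l1_norm X < l1_norm Z" if "A *v Z = A *v X" "Z \<noteq> X" for Z
    using l1_norm_less[OF that assms] .
  have "X \<in> BP_minimizers A (A *v X)"
    unfolding BP_minimizers_def using less by (smt (verit) mem_Collect_eq)
  moreover have "Z = X" if "Z \<in> BP_minimizers A (A *v X)" for Z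
  proof (rule ccontr)
    assume "Z \<noteq> X"
    moreover have "A *v Z = A *v X" "l1_norm Z \<le> l1_norm X"
      using that by (auto simp: BP_minimizers_def)
    ultimately show False using less[of Z] by simp
  qed
  ultimately show ?thesis unfolding BP_recovers_def by blast
qed

section \<open>Orthogonal Matching Pursuit\<close>

lemma max_correlation_in_support:
  assumes supp: "support c \<subseteq> T" and "c \<noteq> 0" and T: "(2 * real (card T) - 1) * \<mu> < 1"
    and max: "\<And>i. cmod (hermitian (column i A) (A *v c)) \<le> cmod (hermitian (column j A) (A *v c))"
  shows "j \<in> T" and "hermitian (column j A) (A *v c) \<noteq> 0"
proof -
  \<comment> \<open>With s = \<open>card T\<close>, the column of a largest entry has correlation at
    least C - \<mu> (s - 1) C, while a column outside \<open>T\<close> has at most \<mu> s C. The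
    condition (2 s - 1) \<mu> < 1 separates the two.\<close>
  define C where "C = Max (range (\<lambda>i. cmod (c $ i)))"
  have "C \<in> range (\<lambda>i. cmod (c $ i))" unfolding C_def by (intro Max_in) auto
  then obtain k where k: "cmod (c $ k) = C" by auto
  have le: "cmod (c $ i) \<le> C" for i unfolding C_def by (intro Max_ge) auto
  obtain i where "c $ i \<noteq> 0" using \<open>c \<noteq> 0\<close> by (auto simp: vec_eq_iff)
  then have C: "C > 0" using le[of i] by (meson less_le_trans zero_less_norm_iff)
  then have "k \<in> T" using k supp by (auto simp: support_def)
  have "l1_norm c = (\<Sum>j\<in>T. cmod (c $ j))"
    unfolding l1_norm_def using supp by (intro sum.mono_neutral_right) (auto simp: support_def)
  also have "\<dots> \<le> real (card T) * C"
    using sum_bounded_above[of T "\<lambda>j. cmod (c $ j)" C] le by simp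
  finally have l1: "l1_norm c \<le> real (card T) * C" .
  then have "\<mu> * (l1_norm c - C) \<le> \<mu> * (real (card T) * C - C)"
    using mu_nonneg by (intro mult_left_mono) auto
  moreover have "C - cmod (hermitian (column k A) (A *v c)) \<le> \<mu> * (l1_norm c - C)"
    using correlation_bound[of k c] norm_triangle_ineq2[of "c $ k" "hermitian (column k A) (A *v c)"]
    by (simp add: k norm_minus_commute)
  moreover have "\<mu> * (2 * real (card T) * C - C) < C"
    using mult_strict_right_mono[OF T C] by (simp add: algebra_simps)
  ultimately have *: "\<mu> * (real (card T) * C) < cmod (hermitian (column k A) (A *v c))"
    by (simp add: algebra_simps)
  show "j \<in> T"
  proof (rule ccontr)
    assume "j \<notin> T"
    then have "c $ j = 0" using supp by (auto simp: support_def)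
    then have "cmod (hermitian (column j A) (A *v c)) \<le> \<mu> * l1_norm c"
      using correlation_bound[of j c] by simp
    also have "\<dots> \<le> \<mu> * (real (card T) * C)" using l1 mu_nonneg by (rule mult_left_mono)
    finally show False using * max[of k] by simp
  qed
  have "0 \<le> \<mu> * (real (card T) * C)" using mu_nonneg C by simp
  with * max[of k] have "0 < cmod (hermitian (column j A) (A *v c))" by linarith
  then show "hermitian (column j A) (A *v c) \<noteq> 0" by simp
qed

text \<open>The residual stays the image of a vector supported in \<open>support X\<close>, so each
  choice falls into that support. Its orthogonality to the selected columns prevents repetitions, so
  \<open>k\<close> steps select \<open>k\<close> distinct indices.\<close>

lemma OMP_run_invariant:
  assumes "OMP_run A (A *v X) k S R" and "k \<le> sparsity X"
    and s: "(2 * real (sparsity X) - 1) * \<mu> < 1"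
  shows "S \<subseteq> support X \<and> card S = k \<and> (\<forall>i\<in>S. hermitian (column i A) R = 0) \<and>
    (\<exists>d. support d \<subseteq> S \<and> R = A *v (X - d))"
  using assms(1,2)
proof induction
  case start
  show ?case by (auto simp: support_def intro!: exI[of _ 0])
next
  case (step k S R j)
  then have S: "S \<subseteq> support X" "card S = k"
    and orth: "\<And>i. i \<in> S \<Longrightarrow> hermitian (column i A) R = 0" by auto
  from step obtain d where d: "support d \<subseteq> S" "R = A *v (X - d)" by auto
  \<comment> \<open>Before step \<open>Suc k\<close> only \<open>k\<close> indices are selected,
    fewer than \<open>sparsity X\<close>, so \<open>d\<close> cannot equal \<open>X\<close>.\<close>
  have "X - d \<noteq> 0"
  proof
    assume "X - d = 0"
    then have "support X \<subseteq> S" using d by simp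
    then have "sparsity X \<le> k" unfolding sparsity_def using S by (metis card_mono finite)
    with step.prems show False by simp
  qed
  moreover have "support (X - d) \<subseteq> support X" using d S by (auto simp: support_def)
  ultimately have j: "j \<in> support X" "hermitian (column j A) R \<noteq> 0"
    using max_correlation_in_support[of "X - d" "support X" j] s step.hyps(2)
    unfolding d(2) sparsity_def by auto
  define V where "V = vec.span ((\<lambda>i. column i A) ` insert j S)"
  have V: "vec.subspace V" unfolding V_def by (rule vec.subspace_span)
  have "column i A \<in> V" if "i \<in> insert j S" for i
    unfolding V_def using that by (intro vec.span_base) auto
  then have "\<forall>i\<in>insert j S. hermitian (column i A) (A *v X - orth_proj V (A *v X)) = 0"
    using hermitian_diff_orth_proj[OF V] by blast
  moreover obtain e where "support e \<subseteq> insert j S" "orth_proj V (A *v X) = A *v e"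
    using orth_proj_mem[OF V] span_columns_obtain unfolding V_def by metis
  \<comment> \<open>The correlation of \<open>j\<close> with the residual is nonzero, whereas it is
    zero for all indices selected before.\<close>
  moreover have "j \<notin> S" using j orth by auto
  ultimately have "insert j S \<subseteq> support X" "card (insert j S) = Suc k"
    "\<forall>i\<in>insert j S. hermitian (column i A) (A *v X - orth_proj V (A *v X)) = 0"
    "support e \<subseteq> insert j S \<and> A *v X - orth_proj V (A *v X) = A *v (X - e)"
    using j S by (simp_all add: matrix_vector_mult_diff_distrib)
  then show ?case unfolding V_def by blast
qed

text \<open>After \<open>sparsity X\<close> steps the selected indices fill the support. The
  least-squares error is then zero, and \<open>sparse_kernel_trivial\<close> leaves only
  \<open>X\<close>.\<close>

theorem OMP_recovers:
  assumes s: "(2 * real (sparsity X) - 1) * \<mu> < 1"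
  shows "OMP_recovers A X"
  unfolding OMP_recovers_def
proof (intro allI impI)
  fix S R assume "OMP_run A (A *v X) (sparsity X) S R"
  from OMP_run_invariant[OF this order_refl s] have S: "S = support X"
    unfolding sparsity_def by (metis card_subset_eq finite)
  show "least_squares A (A *v X) S = {X}"
  proof (intro equalityI subsetI)
    fix Z assume "Z \<in> least_squares A (A *v X) S"
    then have Z: "support Z \<subseteq> S" and "norm (A *v X - A *v Z) \<le> norm (A *v X - A *v X)"
      unfolding least_squares_def S by blast+
    then have "A *v (Z - X) = 0" by (simp add: matrix_vector_mult_diff_distrib)
    moreover have "support (Z - X) \<subseteq> support X" using Z S by (auto simp: support_def)
    ultimately have "Z - X = 0" using sparse_kernel_trivial s unfolding sparsity_def by blast
    then show "Z \<in> {X}" by simp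
  qed (simp add: least_squares_def S)
qed

end


subsection \<open>Sums of independent random phases\<close>

text \<open>The interval holds a whole number of periods. The shift \<open>d\<close> absorbs the
  other coordinate and the projection angle in what follows.\<close>

lemma integral_cos_full_periods:
  fixes c d A :: real
  assumes "A > 0" and "c \<noteq> 0" and "c * A = 2 * pi * of_int k"
  shows "(\<integral>x. cos (c * x + d) * indicator {0..A} x \<partial>lborel) = 0"
proof -
  have "(\<integral>x. cos (c * x + d) * indicator {0..A} x \<partial>lborel) = sin (c * A + d) / c - sin (c * 0 + d) / c"
    using assms by (intro integral_FTC_Icc_real) (auto intro!: derivative_eq_intros)
  also have "sin (c * A + d) = sin d"
    unfolding assms(3) sin_add by (simp add: sin_int_2pin cos_int_2pin)
  finally show ?thesis by simp
qed

lemma integral_uniform_square_cos: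
  fixes a b A \<phi> :: real
  assumes "A > 0" and a: "a * A = 2 * pi * of_int i" and b: "b * A = 2 * pi * of_int j"
    and nz: "i \<noteq> 0 \<or> j \<noteq> 0"
  shows "(\<integral>v. cos (a * fst v + b * snd v + \<phi>) \<partial>uniform_measure lborel ({0..A} \<times> {0..A})) = 0"
proof -
  let ?S = "{0..A} \<times> {0..A}"
  let ?f = "\<lambda>v. cos (a * fst v + b * snd v + \<phi>)"
  let ?I = "indicator {0..A} :: real \<Rightarrow> real"
  have S: "emeasure lborel ?S = ennreal (A\<^sup>2)"
    using \<open>A > 0\<close> unfolding lborel_prod[symmetric]
    by (subst lborel.emeasure_pair_measure_Times) (auto simp: power2_eq_square ennreal_mult)
  have "uniform_measure lborel ?S = density lborel (\<lambda>v. ennreal (indicator ?S v / A\<^sup>2))"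
    unfolding uniform_measure_def S
    using \<open>A > 0\<close> by (intro arg_cong[of _ _ "density lborel"] ext)
      (auto simp: indicator_def divide_ennreal[symmetric] simp flip: ennreal_1)
  moreover have [measurable]: "?S \<in> sets borel"
    by (intro borel_closed closed_Times) auto
  moreover have [measurable]: "?f \<in> borel_measurable borel"
    by (intro borel_measurable_continuous_onI continuous_intros)
  ultimately have "(\<integral>v. ?f v \<partial>uniform_measure lborel ?S) = (\<integral>v. (indicator ?S v / A\<^sup>2) *\<^sub>R ?f v \<partial>lborel)"
    by (simp only: integral_density) (subst integral_density; simp)
  also have "\<dots> = (\<integral>v. indicator ?S v * ?f v \<partial>lborel) / A\<^sup>2"
    by simp
  also have "(\<integral>v. indicator ?S v * ?f v \<partial>lborel) = 0"
  proof -
    let ?g = "\<lambda>x y. ?I x * ?I y * cos (a * x + b * y + \<phi>)"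
    have g: "indicator ?S v * ?f v = case_prod ?g v" for v
      by (auto simp: indicator_def split: prod.splits)
    have "integrable lborel (\<lambda>v. indicator ?S v *\<^sub>R ?f v)"
      by (intro borel_integrable_compact compact_Times) (auto intro!: continuous_intros)
    then have int: "integrable (lborel \<Otimes>\<^sub>M lborel) (case_prod ?g)"
      unfolding lborel_prod real_scaleR_def g .
    show ?thesis
    \<comment> \<open>By Fubini it suffices that one inner integral vanishes; integrate first over a
      coordinate whose frequency is nonzero.\<close>
    proof (cases "i = 0")
      case False
      then have "a \<noteq> 0" using a by auto
      have "(\<integral>x. ?g x y \<partial>lborel) = 0" for y
      proof -
        have "(\<integral>x. ?g x y \<partial>lborel) = (\<integral>x. ?I y * (cos (a * x + (b * y + \<phi>)) * ?I x) \<partial>lborel)"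
          by (simp add: mult_ac add_ac)
        also have "\<dots> = 0"
          using integral_cos_full_periods[OF \<open>A > 0\<close> \<open>a \<noteq> 0\<close> a] by simp
        finally show ?thesis .
      qed
      then show ?thesis
        using lborel_pair.integral_snd[OF int] by (simp add: g lborel_prod)
    next
      case True
      then have "b \<noteq> 0" using b nz by auto
      have "(\<integral>y. ?g x y \<partial>lborel) = 0" for x
      proof -
        have "(\<integral>y. ?g x y \<partial>lborel) = (\<integral>y. ?I x * (cos (b * y + (a * x + \<phi>)) * ?I y) \<partial>lborel)"
          by (simp add: mult_ac add_ac)
        also have "\<dots> = 0"
          using integral_cos_full_periods[OF \<open>A > 0\<close> \<open>b \<noteq> 0\<close> b] by simp
        finally show ?thesis .
      qed
      then show ?thesis
        using lborel_pair.integral_fst'[OF int] by (simp add: g lborel_prod)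
    qed
  qed
  finally show ?thesis by simp
qed

text \<open>Three lines at mutual angles of 60 degrees leave every \<open>z\<close> within 30
  degrees of one of them, and cos 30 degrees is \<open>sqrt 3 / 2\<close>.\<close>

lemma exists_large_projection:
  "\<exists>\<phi>\<in>{0, pi / 3, - (pi / 3)}. sqrt 3 / 2 * cmod z \<le> \<bar>Re (cis \<phi> * z)\<bar>"
proof -
  define x y where "x = Re z" and "y = Im z"
  have le: "sqrt 3 / 2 * cmod z \<le> \<bar>t\<bar>" if "3 / 4 * (x\<^sup>2 + y\<^sup>2) \<le> t\<^sup>2" for t
  proof -
    have "(sqrt 3 / 2 * cmod z)\<^sup>2 \<le> t\<^sup>2"
      using that by (simp add: power_mult_distrib power_divide cmod_power2 x_def y_def)
    then have "\<bar>sqrt 3 / 2 * cmod z\<bar> \<le> \<bar>t\<bar>" by (simp only: abs_le_square_iff)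
    then show ?thesis by simp
  qed
  show ?thesis
  proof (cases "3 * y\<^sup>2 \<le> x\<^sup>2")
    case True
    then have "3 / 4 * (x\<^sup>2 + y\<^sup>2) \<le> x\<^sup>2" by simp
    from le[OF this] show ?thesis by (simp add: x_def)
  next
    case False
    then have "\<bar>x\<bar>\<^sup>2 \<le> (sqrt 3 * \<bar>y\<bar>)\<^sup>2" by (simp add: power_mult_distrib)
    then have "\<bar>x\<bar> \<le> sqrt 3 * \<bar>y\<bar>" by (rule power2_le_imp_le) simp
    then have "\<bar>x\<bar> * \<bar>x\<bar> \<le> \<bar>x\<bar> * (sqrt 3 * \<bar>y\<bar>)" by (rule mult_left_mono) simp
    \<comment> \<open>After expanding the squares below, this is exactly the inequality required;
      the sign of \<open>x * y\<close> decides between the two oblique lines.\<close>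
    then have *: "x\<^sup>2 \<le> sqrt 3 * \<bar>x * y\<bar>" by (simp add: power2_eq_square abs_mult mult_ac)
    have sq: "(1 / 2 * x + sqrt 3 / 2 * y)\<^sup>2 = x\<^sup>2 / 4 + 3 * y\<^sup>2 / 4 + sqrt 3 * (x * y) / 2"
      "(1 / 2 * x - sqrt 3 / 2 * y)\<^sup>2 = x\<^sup>2 / 4 + 3 * y\<^sup>2 / 4 - sqrt 3 * (x * y) / 2"
      by (simp_all add: power2_sum power2_diff power_mult_distrib power_divide)
    show ?thesis
    proof (cases "x * y \<ge> 0")
      case True
      then have "sqrt 3 / 2 * cmod z \<le> \<bar>1 / 2 * x + sqrt 3 / 2 * y\<bar>"
        using * by (intro le) (unfold sq, simp add: mult_ac)
      also have "1 / 2 * x + sqrt 3 / 2 * y = Re (cis (- (pi / 3)) * z)"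
        by (simp add: cos_60 sin_60 x_def y_def)
      finally show ?thesis by blast
    next
      case False
      then have "\<bar>x * y\<bar> = - (x * y)" by simp
      then have "x\<^sup>2 \<le> - (sqrt 3 * (x * y))" using * by simp
      then have "sqrt 3 / 2 * cmod z \<le> \<bar>1 / 2 * x - sqrt 3 / 2 * y\<bar>"
        by (intro le) (unfold sq, argo)
      also have "1 / 2 * x - sqrt 3 / 2 * y = Re (cis (pi / 3) * z)"
        by (simp add: cos_60 sin_60 x_def y_def)
      finally show ?thesis by blast
    qed
  qed
qed

text \<open>If the modulus reaches \<open>t\<close>, one of three projections reaches
  \<open>sqrt 3 / 2 * t\<close>. Each is a sum of n independent centred terms in [-1, 1], so
  Hoeffding gives 2 exp (- 2 (3/4 t^2) / (4 n)); three such events yield the factor 6.\<close>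

lemma (in prob_space) random_phase_sum_tail:
  fixes \<theta> :: "'q::finite \<Rightarrow> 'a \<Rightarrow> real"
  assumes indep: "indep_vars (\<lambda>_. borel) \<theta> UNIV"
    and mean: "\<And>q \<phi>. expectation (\<lambda>w. cos (\<theta> q w + \<phi>)) = 0"
    and "t \<ge> 0"
  shows "prob {w\<in>space M. t \<le> cmod (\<Sum>q\<in>UNIV. cis (\<theta> q w))} \<le> 6 * exp (- 3 * t\<^sup>2 / (8 * real CARD('q)))"
proof -
  have [measurable]: "\<theta> q \<in> borel_measurable M" for q
    using indep unfolding indep_vars_def by blast
  let ?n = "real CARD('q)"
  let ?B = "\<lambda>\<phi>. {w\<in>space M. sqrt 3 / 2 * t \<le> \<bar>\<Sum>q\<in>UNIV. cos (\<theta> q w + \<phi>)\<bar>}"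
  let ?\<Phi> = "{0, pi / 3, - (pi / 3)}"
  have B_sets [simp]: "?B \<phi> \<in> sets M" for \<phi>
    by measurable
  have tail: "prob (?B \<phi>) \<le> 2 * exp (- 3 * t\<^sup>2 / (8 * ?n))" for \<phi>
  proof -
    \<comment> \<open>The final argument 0 is the expectation of the whole sum.\<close>
    interpret Hoeffding_ineq M UNIV "\<lambda>q w. cos (\<theta> q w + \<phi>)" "\<lambda>_. -1" "\<lambda>_. 1" 0
    proof unfold_locales
      show "indep_vars (\<lambda>_. borel) (\<lambda>q w. cos (\<theta> q w + \<phi>)) UNIV"
        by (rule indep_vars_compose2[OF indep]) simp
    qed (simp_all add: mean)
    show ?thesis
      using Hoeffding_ineq_abs_ge[of "sqrt 3 / 2 * t"] \<open>t \<ge> 0\<close>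
      by (simp add: power_mult_distrib power_divide field_simps)
  qed
  have "{w\<in>space M. t \<le> cmod (\<Sum>q\<in>UNIV. cis (\<theta> q w))} \<subseteq> (\<Union>\<phi>\<in>?\<Phi>. ?B \<phi>)"
  proof
    fix w assume w: "w \<in> {w\<in>space M. t \<le> cmod (\<Sum>q\<in>UNIV. cis (\<theta> q w))}"
    obtain \<phi> where \<phi>: "\<phi> \<in> ?\<Phi>"
      "sqrt 3 / 2 * cmod (\<Sum>q\<in>UNIV. cis (\<theta> q w)) \<le> \<bar>Re (cis \<phi> * (\<Sum>q\<in>UNIV. cis (\<theta> q w)))\<bar>"
      using exists_large_projection by blast
    have "sqrt 3 / 2 * t \<le> sqrt 3 / 2 * cmod (\<Sum>q\<in>UNIV. cis (\<theta> q w))"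
      using w by (intro mult_left_mono) auto
    also note \<phi>(2)
    also have "Re (cis \<phi> * (\<Sum>q\<in>UNIV. cis (\<theta> q w))) = (\<Sum>q\<in>UNIV. cos (\<theta> q w + \<phi>))"
      by (simp add: sum_distrib_left cis_mult add.commute del: cis.simps(1)) simp
    finally have "w \<in> ?B \<phi>" using w by blast
    then show "w \<in> (\<Union>\<phi>\<in>?\<Phi>. ?B \<phi>)" using \<phi>(1) by blast
  qed
  then have "prob {w\<in>space M. t \<le> cmod (\<Sum>q\<in>UNIV. cis (\<theta> q w))} \<le> prob (\<Union>\<phi>\<in>?\<Phi>. ?B \<phi>)"
    by (rule finite_measure_mono) (intro sets.finite_UN; simp)
  also have "\<dots> \<le> (\<Sum>\<phi>\<in>?\<Phi>. prob (?B \<phi>))"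
    by (rule finite_measure_subadditive_finite) auto
  also have "\<dots> \<le> (\<Sum>\<phi>\<in>?\<Phi>. 2 * exp (- 3 * t\<^sup>2 / (8 * ?n)))"
    by (rule sum_mono) (rule tail)
  also have "\<dots> = 6 * exp (- 3 * t\<^sup>2 / (8 * ?n))"
  proof -
    have "pi / 3 \<noteq> - (pi / 3)" using pi_gt_zero by linarith
    then show ?thesis by (simp add: card_insert_if)
  qed
  finally show ?thesis .
qed

section \<open>Lattice differences and column correlations of the sensing matrix\<close>

definition lattice_differences :: "nat \<Rightarrow> (int \<times> int) set" where
  "lattice_differences p = {1 - int p..int p - 1} \<times> {1 - int p..int p - 1} - {(0, 0)}"

lemma finite_lattice_differences [simp]: "finite (lattice_differences p)"
  by (simp add: lattice_differences_def)

text \<open>Each coordinate takes 2 p - 1 values and the origin is removed. Counting differences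
  instead of pairs of columns keeps the union bound linear in m = p^2.\<close>

lemma card_lattice_differences:
  assumes "p > 0"
  shows "card (lattice_differences p) = 4 * (p * (p - 1))"
proof -
  obtain k where p: "p = Suc k" using assms by (cases p) auto
  have "card (lattice_differences p) = (2 * k + 1) * (2 * k + 1) - 1"
    unfolding lattice_differences_def p
    by (subst card_Diff_singleton) (auto simp: card_cartesian_product nat_add_distrib nat_mult_distrib)
  then show ?thesis by (simp add: p algebra_simps)
qed

text \<open>In the phase difference of two columns the squares of the sensor coordinates cancel.
  What remains is linear in these coordinates, plus a constant \<beta> that is the same for all
  sensors and so factors out.\<close>

lemma hermitian_sa_columns:
  fixes r :: "'m::finite \<Rightarrow> real \<times> real \<times> real" and u v :: "'n::finite \<Rightarrow> real"
    and \<omega> :: real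
  assumes "z0 > 0"
    and ri: "r i = (x0 + l * real a, y0 + l * real b, z0)"
    and rj: "r j = (x0 + l * real a', y0 + l * real b', z0)"
  defines "B \<equiv> sa_matrix \<omega> r (\<lambda>q. (u q, v q, 0)) :: complex^'m^'n"
    and "\<kappa> \<equiv> 2 * \<omega> * l / z0"
  shows "\<exists>\<beta>. hermitian (column i B) (column j B) = cis \<beta> / of_nat CARD('n) *
    (\<Sum>q\<in>UNIV. cis (\<kappa> * of_int (int a - int a') * u q + \<kappa> * of_int (int b - int b') * v q))"
proof -
  define n where "n = real CARD('n)"
  have "n > 0" by (simp add: n_def)
  define f where "f x y q = \<omega> / z0 * ((x - u q)\<^sup>2 + (y - v q)\<^sup>2)" for x y q
  define xi yi xj yj where "xi = x0 + l * real a" and "yi = y0 + l * real b"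
    and "xj = x0 + l * real a'" and "yj = y0 + l * real b'"
  define \<beta> where "\<beta> = \<omega> / z0 * (xj\<^sup>2 + yj\<^sup>2 - xi\<^sup>2 - yi\<^sup>2)"
  have Bi: "B $ q $ i = cis (2 * \<omega> * z0) * (1 / of_real (sqrt n) * cis (f xi yi q))" for q
    unfolding B_def f_def cis_conv_exp n_def xi_def yi_def
    by (rule sa_matrix_nth[where r=r and j=i, OF \<open>z0 > 0\<close> ri]) simp
  have Bj: "B $ q $ j = cis (2 * \<omega> * z0) * (1 / of_real (sqrt n) * cis (f xj yj q))" for q
    unfolding B_def f_def cis_conv_exp n_def xj_def yj_def
    by (rule sa_matrix_nth[where r=r and j=j, OF \<open>z0 > 0\<close> rj]) simp
  have "cnj (B $ q $ i) * B $ q $ j = cis \<beta> / of_real n *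
      cis (\<kappa> * of_int (int a - int a') * u q + \<kappa> * of_int (int b - int b') * v q)" for q
  proof -
    have "cnj (B $ q $ i) * B $ q $ j =
        (cis (- (2 * \<omega> * z0)) * cis (2 * \<omega> * z0)) * (cis (- f xi yi q) * cis (f xj yj q)) /
        (of_real (sqrt n) * of_real (sqrt n))"
      unfolding Bi Bj by (simp add: cis_cnj mult_ac)
    also have "\<dots> = cis (f xj yj q - f xi yi q) / of_real n"
      using \<open>n > 0\<close> by (simp add: cis_mult flip: of_real_mult)
    also have "f xj yj q - f xi yi q =
        \<beta> + (\<kappa> * of_int (int a - int a') * u q + \<kappa> * of_int (int b - int b') * v q)"
      unfolding f_def \<beta>_def \<kappa>_def xi_def yi_def xj_def yj_def using \<open>z0 > 0\<close>
      by (simp add: field_simps power2_eq_square)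
    finally show ?thesis by (simp add: cis_mult)
  qed
  then show ?thesis
    unfolding hermitian_def column_def
    by (intro exI[of _ \<beta>]) (simp add: sum_distrib_left n_def)
qed

section \<open>Union bound over the lattice differences and exact recovery\<close>

theorem mainTheorem10:
  fixes z0 l A lam \<omega> \<rho> \<delta> K x0 y0 :: real and m n p :: nat
    and r :: "'m::finite \<Rightarrow> real \<times> real \<times> real"
    and M :: "'a measure"
    and \<xi> \<eta> :: "'n::finite \<Rightarrow> 'a \<Rightarrow> real"
  assumes "z0 > 0" and "l > 0" and "A > 0" and "lam > 0"
    and "\<omega> = 2 * pi / lam"
    and "m = CARD('m)" and "n = CARD('n)"
    and "m = p\<^sup>2"
    and "bij_betw r UNIV (square_lattice (x0, y0, z0) l p)"
    and "prob_space M"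
    and "prob_space.indep_vars M (\<lambda>_. borel) (\<lambda>q w. (\<xi> q w, \<eta> q w)) UNIV"
    and "\<And>q. distr M borel (\<lambda>w. (\<xi> q w, \<eta> q w)) = uniform_measure lborel ({0..A} \<times> {0..A})"
    and "\<rho> = lam * z0 / (l * A)"
    and "2 / \<rho> \<in> \<nat>"
    and "\<delta> > 0" and "K > 0"
    and "real m \<le> \<delta> / 2 * exp (K\<^sup>2 / 2)"
  shows "\<exists>E \<in> sets M.
    measure M E > 1 - 2 * \<delta> - \<rho> * real n * (real n - 1) powr (3 / 2) / sqrt (real m) \<and>
    (\<forall>w\<in>E. \<forall>X :: complex^'m.
       real (sparsity X) < 1 / 2 * (1 + sqrt (real n) / (sqrt 2 * K)) \<longrightarrow>
         BP_recovers (sa_matrix \<omega> r (\<lambda>q. (\<xi> q w, \<eta> q w, 0)) :: complex^'m^'n) X \<and>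
         OMP_recovers (sa_matrix \<omega> r (\<lambda>q. (\<xi> q w, \<eta> q w, 0)) :: complex^'m^'n) X)"
proof -
  interpret prob_space M by fact
  have "n > 0" "m > 0" using assms(6,7) by simp_all
  then have "p > 0" using \<open>m = p\<^sup>2\<close> by (cases p) auto
  have "\<rho> > 0" using assms by simp
  then have extra: "\<rho> * real n * (real n - 1) powr (3 / 2) / sqrt (real m) \<ge> 0" by simp
  show ?thesis
  proof (cases "\<delta> \<le> 1 / 2")
    \<comment> \<open>For \<delta> > 1/2 the required probability is negative, so the empty event
      qualifies.\<close>
    case False
    then show ?thesis using extra by (intro bexI[of _ "{}"]) auto
  next
    case True
    obtain N :: nat where N: "2 / \<rho> = real N" using \<open>2 / \<rho> \<in> \<nat>\<close> by (auto elim: Nats_cases)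
    then have "N > 0" using \<open>\<rho> > 0\<close> by (cases N) auto
    define \<kappa> where "\<kappa> = 2 * \<omega> * l / z0"
    \<comment> \<open>Since \<kappa> A = 2 pi (2 / \<rho>), integrality of 2 / \<rho> means that
      every phase runs through full periods across the aperture.\<close>
    have \<kappa>: "\<kappa> * A = 2 * pi * real N"
      unfolding N[symmetric] \<kappa>_def assms(5,13) using assms(1-4) by (simp add: field_simps)
    define \<theta> where "\<theta> d q w = \<kappa> * of_int (fst d) * \<xi> q w + \<kappa> * of_int (snd d) * \<eta> q w"
      for d :: "int \<times> int" and q w
    \<comment> \<open>Chosen so that \<open>t / real n\<close> is the target coherence sqrt 2 K /
      sqrt n.\<close>
    define t where "t = sqrt 2 * K * sqrt (real n)"
    have "t \<ge> 0" using \<open>K > 0\<close> by (simp add: t_def)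
    have loc_meas: "(\<lambda>w. (\<xi> q w, \<eta> q w)) \<in> borel_measurable M" for q
      using assms(11) unfolding indep_vars_def by blast
    have [measurable]: "\<xi> q \<in> borel_measurable M" "\<eta> q \<in> borel_measurable M" for q
      using measurable_compose[OF loc_meas borel_measurable_continuous_onI[OF continuous_on_fst[OF continuous_on_id]]]
        measurable_compose[OF loc_meas borel_measurable_continuous_onI[OF continuous_on_snd[OF continuous_on_id]]]
      by simp_all
    have \<theta>_meas [measurable]: "\<theta> d q \<in> borel_measurable M" for d q
      unfolding \<theta>_def by measurable
    have cis_meas [measurable]: "cis \<in> borel_measurable borel"
      by (intro borel_measurable_continuous_onI continuous_intros)
    define bad where "bad d = {w\<in>space M. t \<le> cmod (\<Sum>q\<in>UNIV. cis (\<theta> d q w))}" for d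
    have bad_sets [measurable]: "bad d \<in> sets M" for d unfolding bad_def by measurable
    have tail: "prob (bad d) \<le> 6 * exp (- 3 / 4 * K\<^sup>2)" if d: "d \<in> lattice_differences p" for d
    proof -
      have "fst d \<noteq> 0 \<or> snd d \<noteq> 0"
        using d by (cases d) (auto simp: lattice_differences_def)
      then have nz: "int N * fst d \<noteq> 0 \<or> int N * snd d \<noteq> 0" using \<open>N > 0\<close> by simp
      have per: "\<kappa> * of_int z * A = 2 * pi * of_int (int N * z)" for z
        using \<kappa> by (simp add: mult_ac)
      have mean: "expectation (\<lambda>w. cos (\<theta> d q w + \<phi>)) = 0" for q \<phi>
      proof -
        have "expectation (\<lambda>w. cos (\<theta> d q w + \<phi>)) = (\<integral>v. cos (\<kappa> * of_int (fst d) * fst v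
            + \<kappa> * of_int (snd d) * snd v + \<phi>) \<partial>distr M borel (\<lambda>w. (\<xi> q w, \<eta> q w)))"
          unfolding \<theta>_def
          by (subst integral_distr[OF loc_meas])
            (auto intro!: borel_measurable_continuous_onI continuous_intros)
        also have "\<dots> = 0"
          unfolding assms(12) using nz
          by (intro integral_uniform_square_cos[OF \<open>A > 0\<close> per per])
        finally show ?thesis .
      qed
      have "(\<lambda>v. \<kappa> * of_int (fst d) * fst v + \<kappa> * of_int (snd d) * snd v) \<in> borel_measurable borel"
        by (intro borel_measurable_continuous_onI continuous_intros)
      from indep_vars_compose2[OF assms(11) this]
      have indep: "indep_vars (\<lambda>_. borel) (\<theta> d) UNIV" unfolding \<theta>_def by simp
      have "prob (bad d) \<le> 6 * exp (- 3 * t\<^sup>2 / (8 * real CARD('n)))"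
        unfolding bad_def by (rule random_phase_sum_tail[OF indep mean \<open>t \<ge> 0\<close>])
      also have "- 3 * t\<^sup>2 / (8 * real CARD('n)) = - 3 / 4 * K\<^sup>2"
        using \<open>n > 0\<close> unfolding t_def \<open>n = CARD('n)\<close>[symmetric] by (simp add: power_mult_distrib)
      finally show ?thesis .
    qed
    \<comment> \<open>\<open>E\<close> is fixed by the sensors alone, so recovery on it holds for
      all \<open>X\<close> simultaneously.\<close>
    define E where "E = space M - (\<Union>d\<in>lattice_differences p. bad d)"
    have E: "E \<in> sets M" unfolding E_def by measurable
    have union: "prob (\<Union>d\<in>lattice_differences p. bad d) < 2 * \<delta>"
    proof -
      have "prob (\<Union>d\<in>lattice_differences p. bad d) \<le> (\<Sum>d\<in>lattice_differences p. prob (bad d))"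
        by (rule finite_measure_subadditive_finite) auto
      also have "\<dots> \<le> (\<Sum>d\<in>lattice_differences p. 6 * exp (- 3 / 4 * K\<^sup>2))"
        by (rule sum_mono) (rule tail)
      also have "\<dots> = 24 * (real p * (real p - 1)) * exp (- 3 / 4 * K\<^sup>2)"
        using \<open>p > 0\<close> by (simp add: card_lattice_differences of_nat_diff)
      also have "\<dots> < 2 * \<delta>"
      proof -
        \<comment> \<open>With this \<open>x\<close> the tail is 6 x^3 and the hypothesis on
          \<open>m\<close> reads 2 (p x)^2 \<le> \<delta>. As \<delta> \<le> 1/2, also 2 p x \<le>
          1, which pays for the third power.\<close>
        define x where "x = exp (- K\<^sup>2 / 4)"
        have "x > 0" by (simp add: x_def)
        have x2: "x\<^sup>2 = exp (- (K\<^sup>2 / 2))" and x3: "x ^ 3 = exp (- 3 / 4 * K\<^sup>2)"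
          unfolding x_def by (simp_all flip: exp_of_nat_mult)
        have "exp (K\<^sup>2 / 2) * x\<^sup>2 = 1" unfolding x2 by (simp flip: exp_add)
        then have px: "2 * (real p * x)\<^sup>2 \<le> \<delta>"
          using mult_right_mono[OF assms(17), of "2 * x\<^sup>2"] \<open>m = p\<^sup>2\<close>
          by (simp add: power_mult_distrib mult_ac)
        then have "(2 * real p * x)\<^sup>2 \<le> 1\<^sup>2" using True by (simp add: power_mult_distrib)
        then have x1: "2 * real p * x \<le> 1" by (rule power2_le_imp_le) simp
        \<comment> \<open>Trading 4 (p - 1) for p^2 leaves the bound 6 (p x)^3, a function of p x
          alone.\<close>
        have "0 \<le> (real p - 2)\<^sup>2" by simp
        then have p4: "4 * (real p - 1) \<le> real p * real p" by (simp add: power2_eq_square algebra_simps)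
        have "24 * (real p * (real p - 1)) * x ^ 3 = 6 * (4 * (real p - 1)) * (real p * x ^ 3)"
          by simp
        also have "\<dots> \<le> 6 * (real p * real p) * (real p * x ^ 3)"
          using p4 \<open>x > 0\<close> by (intro mult_right_mono mult_left_mono) auto
        also have "\<dots> = 3 / 2 * (2 * (real p * x)\<^sup>2) * (2 * real p * x)"
          by (simp add: power2_eq_square power3_eq_cube)
        also have "\<dots> \<le> 3 / 2 * \<delta> * 1"
          using px x1 \<open>x > 0\<close> \<open>\<delta> > 0\<close> by (intro mult_mono) auto
        also have "\<dots> < 2 * \<delta>" using \<open>\<delta> > 0\<close> by simp
        finally show ?thesis unfolding x3 .
      qed
      finally show ?thesis .
    qed
    have "prob E = 1 - prob (\<Union>d\<in>lattice_differences p. bad d)"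
      unfolding E_def by (rule prob_compl) measurable
    with union extra have "measure M E > 1 - 2 * \<delta> - \<rho> * real n * (real n - 1) powr (3 / 2) / sqrt (real m)"
      by linarith
    moreover have "BP_recovers (sa_matrix \<omega> r (\<lambda>q. (\<xi> q w, \<eta> q w, 0)) :: complex^'m^'n) X \<and>
         OMP_recovers (sa_matrix \<omega> r (\<lambda>q. (\<xi> q w, \<eta> q w, 0)) :: complex^'m^'n) X"
      if w: "w \<in> E" and X: "real (sparsity X) < 1 / 2 * (1 + sqrt (real n) / (sqrt 2 * K))"
      for w and X :: "complex^'m"
    proof -
      define B where "B = (sa_matrix \<omega> r (\<lambda>q. (\<xi> q w, \<eta> q w, 0)) :: complex^'m^'n)"
      have r: "\<exists>a b. a < p \<and> b < p \<and> r i = (x0 + l * real a, y0 + l * real b, z0)" for i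
      proof -
        have "r i \<in> square_lattice (x0, y0, z0) l p"
          using bij_betwE[OF assms(9)] by blast
        then show ?thesis by (auto simp: square_lattice_def)
      qed
      have herm: "\<exists>\<beta>. hermitian (column i B) (column j B) = cis \<beta> / of_nat n *
            (\<Sum>q\<in>UNIV. cis (\<theta> (int a - int a', int b - int b') q w))"
        if "r i = (x0 + l * real a, y0 + l * real b, z0)"
          "r j = (x0 + l * real a', y0 + l * real b', z0)" for i j a b a' b'
        using hermitian_sa_columns[OF \<open>z0 > 0\<close> that, of \<omega> "\<lambda>q. \<xi> q w" "\<lambda>q. \<eta> q w"]
        unfolding B_def \<theta>_def \<kappa>_def \<open>n = CARD('n)\<close> by simp
      interpret incoherent B "t / real n"
      proof
        show "t / real n \<ge> 0" using \<open>t \<ge> 0\<close> by simp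
        show "hermitian (column i B) (column i B) = 1" for i
        proof -
          obtain a b where ri: "r i = (x0 + l * real a, y0 + l * real b, z0)" using r[of i] by blast
          \<comment> \<open>For equal lattice points all phases are zero, so the product is
            unimodular; being also a squared norm, it must be 1.\<close>
          obtain \<beta> where \<beta>: "hermitian (column i B) (column i B) = cis \<beta>"
            using herm[OF ri ri] \<open>n > 0\<close> by (auto simp: \<theta>_def \<open>n = CARD('n)\<close>)
          have "cmod (of_real ((norm (column i B))\<^sup>2)) = 1"
            unfolding hermitian_self[symmetric] \<beta> by simp
          then have "(norm (column i B))\<^sup>2 = 1" unfolding norm_of_real by simp
          then show ?thesis by (simp only: hermitian_self of_real_1)
        qed
        show "cmod (hermitian (column i B) (column j B)) \<le> t / real n" if "i \<noteq> j" for i j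
        proof -
          obtain a b where ri: "r i = (x0 + l * real a, y0 + l * real b, z0)" and ab: "a < p" "b < p"
            using r[of i] by blast
          obtain a' b' where rj: "r j = (x0 + l * real a', y0 + l * real b', z0)" and ab': "a' < p" "b' < p"
            using r[of j] by blast
          let ?d = "(int a - int a', int b - int b')"
          \<comment> \<open>Injectivity of the enumeration makes the difference nonzero, so its bad
            event was excluded from \<open>E\<close>.\<close>
          have "r i \<noteq> r j" using assms(9) \<open>i \<noteq> j\<close> by (auto simp: bij_betw_def dest: injD)
          then have "?d \<in> lattice_differences p"
            using ri rj ab ab' by (auto simp: lattice_differences_def)
          then have "cmod (\<Sum>q\<in>UNIV. cis (\<theta> ?d q w)) < t"
            using w unfolding E_def bad_def by auto
          moreover have "cmod (hermitian (column i B) (column j B))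
              = cmod (\<Sum>q\<in>UNIV. cis (\<theta> ?d q w)) / real n"
            using herm[OF ri rj] by (auto simp: norm_mult norm_divide)
          ultimately show ?thesis using \<open>n > 0\<close> by (simp add: divide_right_mono)
        qed
      qed
      have "t / real n > 0" using \<open>K > 0\<close> \<open>n > 0\<close> by (simp add: t_def)
      moreover have "sqrt (real n) / (sqrt 2 * K) = 1 / (t / real n)"
        using \<open>K > 0\<close> \<open>n > 0\<close> by (simp add: t_def field_simps)
      \<comment> \<open>With \<mu> = \<open>t / real n\<close>, the sparsity hypothesis s < (1 +
        1/\<mu>) / 2 is the coherence condition (2 s - 1) \<mu> < 1.\<close>
      moreover have "2 * real (sparsity X) - 1 < sqrt (real n) / (sqrt 2 * K)"
      proof -
        have "2 * s - 1 < u" if "s < 1 / 2 * (1 + u)" for s u :: real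
          using that by simp
        from this[OF X] show ?thesis .
      qed
      ultimately have "(2 * real (sparsity X) - 1) * (t / real n) < 1"
        by (simp only: pos_less_divide_eq)
      then show ?thesis using BP_recovers OMP_recovers unfolding B_def by blast
    qed
    ultimately show ?thesis using E by blast
  qed
qed

end
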